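(* Let $\alpha\in[0,1]$ and suppose the volume quadrature rule is exact for polynomials of degree at least $2p-1$ on $[-1,1]$. If $\hat{\boldsymbol u}_m(t)$ satisfies the ESFR strong split form for Burgers' equation on an element $m$, $$\frac{d}{dt}\hat{\boldsymbol u}_m^T=-\alpha(\boldsymbol M_m+\boldsymbol K_m)^{-1}\boldsymbol S_\xi\hat{\boldsymbol f}_m^{T}-(1-\alpha)(\boldsymbol M_m+\boldsymbol K_m)^{-1}\boldsymbol\chi(\boldsymbol\xi_v)^T\boldsymbol U\boldsymbol W\frac{\partial\boldsymbol\chi(\boldsymbol\xi_v)}{\partial\xi}\hat{\boldsymbol u}_m^T-(\boldsymbol M_m+\boldsymbol K_m)^{-1}\sum_{f\in\{L,R\}}\boldsymbol\chi(\xi_f)^T\,\hat n_f\Big(f^{*}_{m,f}-\alpha\,\boldsymbol\chi(\xi_f)\hat{\boldsymbol f}_m^{T}-(1-\alpha)f_{f}\Big),$$ then the scheme is conservative in the sense that $$\hat{\boldsymbol 1}(\boldsymbol M_m+\boldsymbol K_m)\frac{d}{dt}\hat{\boldsymbol u}_m^T=-\hat{\boldsymbol 1}\sum_{f\in\{L,R\}}\boldsymbol\chi(\xi_f)^T\,\hat n_f\,f^{*}_{m,f}.$$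
   Context: Setting: the one-dimensional Burgers' equation $\partial_t u+\partial_x(u^2/2)=0$, discretized on elements, each mapped affinely from the reference element $[-1,1]$ (coordinate $\xi$) with constant Jacobian determinant $J_m>0$. Vectors of coefficients and nodal values are row vectors. Let $p\ge 1$ and let $\boldsymbol\chi(\xi)=[\chi_1(\xi),\dots,\chi_{p+1}(\xi)]$ be a (modal or nodal) basis of the polynomials of degree at most $p$ on $[-1,1]$. The discrete solution on element $m$ is $u_m(\xi,t)=\boldsymbol\chi(\xi)\hat{\boldsymbol u}_m(t)^T$. The volume quadrature has nodes $\boldsymbol\xi_v=(\xi_{v,1},\dots,\xi_{v,N_{vp}})$ in $[-1,1]$ and $\boldsymbol W$ is the diagonal matrix of its weights. $\boldsymbol\chi(\boldsymbol\xi_v)$ is the $N_{vp}\times(p+1)$ matrix with entries $\chi_j(\xi_{v,i})$, and $\partial\boldsymbol\chi(\boldsymbol\xi_v)/\partial\xi$ is the matrix with entries $\chi_j'(\xi_{v,i})$. The volume nodes need not coincide with interpolation nodes of the basis nor contain the endpoints. The faces are $L,R$ with $\xi_L=-1$, $\xi_R=1$, outward normals $\hat n_L=-1$, $\hat n_R=1$ (face quadrature weight $1$). Operators: $\boldsymbol M=\boldsymbol\chi(\boldsymbol\xi_v)^T\boldsymbol W\boldsymbol\chi(\boldsymbol\xi_v)$, $\boldsymbol M_m=J_m\boldsymbol M$, $\boldsymbol S_\xi=\boldsymbol\chi(\boldsymbol\xi_v)^T\boldsymbol W\,\partial\boldsymbol\chi(\boldsymbol\xi_v)/\partial\xi$,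 $\boldsymbol D^p=(\boldsymbol M^{-1}\boldsymbol S_\xi)^p$, and the ESFR correction operator $\boldsymbol K_m=c\,(\boldsymbol D^p)^T\boldsymbol M_m\boldsymbol D^p$, where $c$ is a real correction parameter. The matrices $\boldsymbol M$ and $\boldsymbol M_m+\boldsymbol K_m$ are invertible. The discrete $L_2$ projection is $\boldsymbol\Pi_m^p=\boldsymbol M_m^{-1}\boldsymbol\chi(\boldsymbol\xi_v)^T\boldsymbol W J_m$. Fluxes: $\boldsymbol u_m^T=\boldsymbol\chi(\boldsymbol\xi_v)\hat{\boldsymbol u}_m^T$ is the vector of solution values at volume nodes and $\boldsymbol U=\mathrm{diag}(\boldsymbol u_m)$. The modal flux coefficients are $\hat{\boldsymbol f}_m^T=\boldsymbol\Pi_m^p\big(\tfrac12\boldsymbol U\boldsymbol u_m^T\big)$. The face flux is $f_f=\tfrac12\big(\boldsymbol\chi(\xi_f)\hat{\boldsymbol u}_m^T\big)^2$. $f^{*}_{m,f}\in\mathbb R$ is the value of the numerical flux at face $f$. $\hat{\boldsymbol 1}$ is the coefficient row vector of the constant function $1$, i.e. $\boldsymbol\chi(\xi)\hat{\boldsymbol 1}^T=1$ for all $\xi$. *)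

theory Defs
  imports "HOL-Analysis.Analysis" "HOL-Computational_Algebra.Polynomial"
begin

(* Row vectors and their transposes are both represented by real^'n; whether a vector acts as a
   row or a column is decided by *v and the inner product.  The basis is indexed by 'n (with
   CARD('n) = p + 1) and the volume quadrature nodes by 'v. *)

interpretation real_poly: vector_space "smult :: real \<Rightarrow> real poly \<Rightarrow> real poly"
  by unfold_locales (simp_all add: smult_add_right smult_add_left)

definition poly_basis :: "nat \<Rightarrow> ('n::finite \<Rightarrow> real poly) \<Rightarrow> bool" where
  "poly_basis p B \<longleftrightarrow>
     inj B \<and> real_poly.independent (range B) \<and> real_poly.span (range B) = {q. degree q \<le> p}"

definition diag_mat :: "real^'v \<Rightarrow> real^'v^'v" where
  "diag_mat x = (\<chi> i j. if i = j then x $ i else 0)"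

(* The componentwise product of the type vec makes A ^ k the entrywise power, so powers of
   matrices with respect to ** are defined separately. *)
definition mat_pow :: "real^'n^'n \<Rightarrow> nat \<Rightarrow> real^'n^'n" where
  "mat_pow A k = (((**) A) ^^ k) (mat 1)"

definition basis_row :: "('n::finite \<Rightarrow> real poly) \<Rightarrow> real \<Rightarrow> real^'n" where
  "basis_row B x = (\<chi> j. poly (B j) x)"

definition basis_mat :: "('n::finite \<Rightarrow> real poly) \<Rightarrow> real^'v \<Rightarrow> real^'n^'v" where
  "basis_mat B \<xi> = (\<chi> i. basis_row B (\<xi> $ i))"

definition deriv_basis_mat :: "('n::finite \<Rightarrow> real poly) \<Rightarrow> real^'v \<Rightarrow> real^'n^'v" where
  "deriv_basis_mat B \<xi> = basis_mat (\<lambda>j. pderiv (B j)) \<xi>"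

definition quad_exact :: "real^'v \<Rightarrow> real^'v \<Rightarrow> nat \<Rightarrow> bool" where
  "quad_exact \<xi> w d \<longleftrightarrow>
     (\<forall>q :: real poly. degree q \<le> d \<longrightarrow>
        (\<Sum>i\<in>UNIV. w $ i * poly q (\<xi> $ i)) = integral {-1..1} (poly q))"

datatype face = FaceL | FaceR

fun face_coord :: "face \<Rightarrow> real" where
  "face_coord FaceL = -1"
| "face_coord FaceR = 1"

fun face_normal :: "face \<Rightarrow> real" where
  "face_normal FaceL = -1"
| "face_normal FaceR = 1"

definition ref_mass :: "('n::finite \<Rightarrow> real poly) \<Rightarrow> real^'v \<Rightarrow> real^'v \<Rightarrow> real^'n^'n" where
  "ref_mass B \<xi> w = transpose (basis_mat B \<xi>) ** diag_mat w ** basis_mat B \<xi>"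

definition elem_mass ::
    "('n::finite \<Rightarrow> real poly) \<Rightarrow> real^'v \<Rightarrow> real^'v \<Rightarrow> real \<Rightarrow> real^'n^'n" where
  "elem_mass B \<xi> w J = J *\<^sub>R ref_mass B \<xi> w"

definition stiffness :: "('n::finite \<Rightarrow> real poly) \<Rightarrow> real^'v \<Rightarrow> real^'v \<Rightarrow> real^'n^'n" where
  "stiffness B \<xi> w = transpose (basis_mat B \<xi>) ** diag_mat w ** deriv_basis_mat B \<xi>"

definition deriv_op_pow ::
    "nat \<Rightarrow> ('n::finite \<Rightarrow> real poly) \<Rightarrow> real^'v \<Rightarrow> real^'v \<Rightarrow> real^'n^'n" where
  "deriv_op_pow p B \<xi> w = mat_pow (matrix_inv (ref_mass B \<xi> w) ** stiffness B \<xi> w) p"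

definition esfr_correction ::
    "nat \<Rightarrow> ('n::finite \<Rightarrow> real poly) \<Rightarrow> real^'v \<Rightarrow> real^'v \<Rightarrow> real \<Rightarrow> real \<Rightarrow> real^'n^'n" where
  "esfr_correction p B \<xi> w J c =
     c *\<^sub>R (transpose (deriv_op_pow p B \<xi> w) ** elem_mass B \<xi> w J ** deriv_op_pow p B \<xi> w)"

definition esfr_mass ::
    "nat \<Rightarrow> ('n::finite \<Rightarrow> real poly) \<Rightarrow> real^'v \<Rightarrow> real^'v \<Rightarrow> real \<Rightarrow> real \<Rightarrow> real^'n^'n" where
  "esfr_mass p B \<xi> w J c = elem_mass B \<xi> w J + esfr_correction p B \<xi> w J c"

definition l2_proj ::
    "('n::finite \<Rightarrow> real poly) \<Rightarrow> real^'v \<Rightarrow> real^'v \<Rightarrow> real \<Rightarrow> real^'v^'n" where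
  "l2_proj B \<xi> w J =
     J *\<^sub>R (matrix_inv (elem_mass B \<xi> w J) ** transpose (basis_mat B \<xi>) ** diag_mat w)"

(* In the following, a is the vector of solution coefficients at a fixed time. *)

definition sol_diag :: "('n::finite \<Rightarrow> real poly) \<Rightarrow> real^'v \<Rightarrow> real^'n \<Rightarrow> real^'v^'v" where
  "sol_diag B \<xi> a = diag_mat (basis_mat B \<xi> *v a)"

definition modal_flux ::
    "('n::finite \<Rightarrow> real poly) \<Rightarrow> real^'v \<Rightarrow> real^'v \<Rightarrow> real \<Rightarrow> real^'n \<Rightarrow> real^'n" where
  "modal_flux B \<xi> w J a =
     l2_proj B \<xi> w J *v ((1/2) *\<^sub>R (sol_diag B \<xi> a *v (basis_mat B \<xi> *v a)))"

definition face_flux :: "('n::finite \<Rightarrow> real poly) \<Rightarrow> real^'n \<Rightarrow> face \<Rightarrow> real" where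
  "face_flux B a f = (1/2) * (basis_row B (face_coord f) \<bullet> a)\<^sup>2"

definition esfr_split_rhs ::
    "nat \<Rightarrow> ('n::finite \<Rightarrow> real poly) \<Rightarrow> real^'v \<Rightarrow> real^'v \<Rightarrow> real \<Rightarrow> real \<Rightarrow> real
      \<Rightarrow> (face \<Rightarrow> real) \<Rightarrow> real^'n \<Rightarrow> real^'n" where
  "esfr_split_rhs p B \<xi> w J c \<alpha> fstar a =
     - (\<alpha> *\<^sub>R ((matrix_inv (esfr_mass p B \<xi> w J c) ** stiffness B \<xi> w) *v modal_flux B \<xi> w J a))
     - (1 - \<alpha>) *\<^sub>R
         ((matrix_inv (esfr_mass p B \<xi> w J c) ** transpose (basis_mat B \<xi>) ** sol_diag B \<xi> a
             ** diag_mat w ** deriv_basis_mat B \<xi>) *v a)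
     - matrix_inv (esfr_mass p B \<xi> w J c) *v
         (\<Sum>f\<in>{FaceL, FaceR}.
            (face_normal f *
              (fstar f - \<alpha> * (basis_row B (face_coord f) \<bullet> modal_flux B \<xi> w J a)
                 - (1 - \<alpha>) * face_flux B a f))
            *\<^sub>R basis_row B (face_coord f))"

end

theory Submission
  imports Defs
begin

text \<open>
  Why the scheme is conservative: multiplying the scheme by \<open>esfr_mass\<close> cancels its inverse.
  Testing with the coefficients of the constant function 1 then turns both volume terms into
  quadratures of derivatives. For the conservative part this is the
  derivative of the projected flux polynomial; for the advective part it is \<open>q * q' = (q\<^sup>2 / 2)'\<close>,
  where \<open>q\<close> is the solution polynomial. These integrands have degrees at most \<open>p - 1\<close> and
  \<open>2 * p - 1\<close>, so the quadrature is exact and the fundamental theorem of calculus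
  (\<open>quad_exact_pderiv\<close>) leaves only boundary values. Those are exactly what the face term subtracts
  from the numerical flux: the projected flux at the faces with weight \<open>\<alpha>\<close>
  (\<open>test_one_conservative_volume\<close>) and the flux of the face values with weight \<open>1 - \<alpha>\<close>
  (\<open>test_one_advective_volume\<close>). The basis functions sum to 1 at each face when weighted by
  \<open>one_hat\<close>, so only the numerical flux survives.
\<close>

definition modal_poly :: "('n::finite \<Rightarrow> real poly) \<Rightarrow> real^'n \<Rightarrow> real poly" where
  "modal_poly B a = (\<Sum>j\<in>UNIV. smult (a $ j) (B j))"

lemma basis_row_inner: "basis_row B x \<bullet> a = poly (modal_poly B a) x"
  by (simp add: basis_row_def modal_poly_def inner_vec_def poly_sum mult.commute)

lemma basis_mat_mult_nth: "(basis_mat B \<xi> *v a) $ i = poly (modal_poly B a) (\<xi> $ i)"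
  by (simp add: basis_mat_def matrix_vector_mul_component basis_row_inner)

lemma deriv_basis_mat_mult_nth:
  "(deriv_basis_mat B \<xi> *v a) $ i = poly (pderiv (modal_poly B a)) (\<xi> $ i)"
proof -
  have "modal_poly (\<lambda>j. pderiv (B j)) a = pderiv (modal_poly B a)"
    using higher_pderiv_sum[of 1 "\<lambda>j. smult (a $ j) (B j)" UNIV]
    by (simp add: modal_poly_def pderiv_smult)
  then show ?thesis
    by (simp add: deriv_basis_mat_def basis_mat_mult_nth)
qed

lemma degree_modal_poly:
  assumes "poly_basis p B"
  shows "degree (modal_poly B a) \<le> p"
proof -
  have "degree (B j) \<le> p" for j
    using assms real_poly.span_base[of "B j" "range B"] by (auto simp: poly_basis_def)
  then show ?thesis
    unfolding modal_poly_def by (intro degree_sum_le) (auto intro: order.trans[OF degree_smult_le])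
qed

lemma diag_mat_mult_nth: "(diag_mat x *v y) $ i = x $ i * y $ i"
  by (simp add: diag_mat_def matrix_vector_mult_def if_distrib[of "\<lambda>z. z * _"] cong: if_cong)

lemma inner_vector_matrix_mult:
  fixes A :: "real^'n::finite^'v::finite"
  shows "a \<bullet> (z v* A) = (A *v a) \<bullet> z"
  by (metis dot_lmul_matrix inner_commute)

lemma matrix_inv_right:
  fixes A :: "'a::semiring_1^'n::finite^'m::finite"
  assumes "invertible A"
  shows "A ** matrix_inv A = mat 1"
  using someI_ex[OF assms[unfolded invertible_def]] by (simp add: matrix_inv_def)

lemma quad_exact_pderiv:
  assumes "quad_exact \<xi> w d" and "degree (pderiv q) \<le> d"
  shows "(\<Sum>i\<in>UNIV. w $ i * poly (pderiv q) (\<xi> $ i)) = poly q 1 - poly q (- 1)"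
proof -
  have "(poly (pderiv q) has_integral (poly q 1 - poly q (- 1))) {-1..1}"
    by (rule fundamental_theorem_of_calculus)
      (auto intro: DERIV_subset[OF poly_DERIV]
        simp flip: has_real_derivative_iff_has_vector_derivative)
  then show ?thesis
    using assms by (simp add: quad_exact_def integral_unique)
qed

text \<open>
  Discrete integration by parts: against the test function 1 the stiffness matrix takes the
  quadrature of a derivative of degree at most \<open>p - 1\<close>. It will be applied with \<open>a\<close> the
  coefficients of the projected flux, so the boundary values are those the face term
  subtracts with weight \<open>\<alpha>\<close>.
\<close>
lemma test_one_conservative_volume:
  assumes basis: "poly_basis p B" and exact: "quad_exact \<xi> w d" and d: "p - 1 \<le> d"
    and one: "\<And>i. basis_row B (\<xi> $ i) \<bullet> one_hat = 1"
  shows "one_hat \<bullet> (stiffness B \<xi> w *v a) = basis_row B 1 \<bullet> a - basis_row B (- 1) \<bullet> a"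
proof -
  have "one_hat \<bullet> (stiffness B \<xi> w *v a) =
      (\<Sum>i\<in>UNIV. w $ i * poly (pderiv (modal_poly B a)) (\<xi> $ i))"
    using one
    by (simp add: stiffness_def inner_vector_matrix_mult inner_vec_def[of "basis_mat B \<xi> *v one_hat"]
        diag_mat_mult_nth basis_mat_mult_nth deriv_basis_mat_mult_nth basis_row_inner
        flip: matrix_vector_mul_assoc)
  also have "\<dots> = poly (modal_poly B a) 1 - poly (modal_poly B a) (- 1)"
    using degree_modal_poly[OF basis, of a] d
    by (intro quad_exact_pderiv[OF exact]) (simp add: degree_pderiv)
  finally show ?thesis
    by (simp add: basis_row_inner)
qed

text \<open>
  The product rule at the nodes: \<open>sol_diag\<close> holds the nodal values of the solution polynomial and
  \<open>deriv_basis_mat\<close> yields those of its exact derivative, so the integrand is the derivative of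
  half the square of that polynomial, of degree at most \<open>2 * p - 1\<close>. This integrand is what forces the required order of the quadrature.
\<close>
lemma test_one_advective_volume:
  assumes basis: "poly_basis p B" and exact: "quad_exact \<xi> w d" and d: "2 * p - 1 \<le> d"
    and one: "\<And>i. basis_row B (\<xi> $ i) \<bullet> one_hat = 1"
  shows "one_hat \<bullet> ((transpose (basis_mat B \<xi>) ** sol_diag B \<xi> a ** diag_mat w
            ** deriv_basis_mat B \<xi>) *v a) = face_flux B a FaceR - face_flux B a FaceL"
proof -
  define q where "q = modal_poly B a"
  \<comment> \<open>the flux polynomial of degree up to \<open>2 * p\<close>, not its projection\<close>
  define F where "F = smult (1/2) (q * q)"
  have pderiv_F: "poly (pderiv F) x = poly q x * poly (pderiv q) x" for x
    by (simp add: F_def pderiv_smult pderiv_mult)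
  have "degree F \<le> 2 * p"
    using degree_mult_le[of q q] degree_modal_poly[OF basis, of a] by (simp add: F_def q_def)
  then have degree_F: "degree (pderiv F) \<le> d"
    using d by (simp add: degree_pderiv)
  have "one_hat \<bullet> ((transpose (basis_mat B \<xi>) ** sol_diag B \<xi> a ** diag_mat w
            ** deriv_basis_mat B \<xi>) *v a) = (\<Sum>i\<in>UNIV. w $ i * poly (pderiv F) (\<xi> $ i))"
    using one
    by (simp add: sol_diag_def inner_vector_matrix_mult inner_vec_def[of "basis_mat B \<xi> *v one_hat"]
        diag_mat_mult_nth basis_mat_mult_nth deriv_basis_mat_mult_nth basis_row_inner pderiv_F
        mult.left_commute flip: matrix_vector_mul_assoc q_def)
  also have "\<dots> = poly F 1 - poly F (- 1)"
    by (rule quad_exact_pderiv[OF exact degree_F])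
  finally show ?thesis
    by (simp add: F_def q_def face_flux_def basis_row_inner power2_eq_square)
qed

theorem mainTheorem1:
  fixes p d :: nat
    and B :: "'n::finite \<Rightarrow> real poly"
    and \<xi> w :: "real^'v"
    and J c \<alpha> :: real
    and T :: "real set"
    and u :: "real \<Rightarrow> real^'n"
    and fstar :: "real \<Rightarrow> face \<Rightarrow> real"
    and one_hat :: "real^'n"
  assumes p: "p \<ge> 1"
    and dim: "CARD('n) = p + 1"
    and basis: "poly_basis p B"
    and nodes: "\<And>i. \<xi> $ i \<in> {-1..1}"
    and J: "J > 0"
    and inv_M: "invertible (ref_mass B \<xi> w)"
    and inv_MK: "invertible (esfr_mass p B \<xi> w J c)"
    and one_hat: "\<And>x. x \<in> {-1..1} \<Longrightarrow> basis_row B x \<bullet> one_hat = 1"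
    and alpha: "\<alpha> \<in> {0..1}"
    and degree_of_exactness: "d \<ge> 2 * p - 1"
    and exact: "quad_exact \<xi> w d"
    and time: "is_interval T" "interior T \<noteq> {}"
    and scheme: "\<And>t. t \<in> T \<Longrightarrow>
      (u has_vector_derivative esfr_split_rhs p B \<xi> w J c \<alpha> (fstar t) (u t)) (at t within T)"
  shows "\<forall>t\<in>T.
    one_hat \<bullet> (esfr_mass p B \<xi> w J c *v vector_derivative u (at t within T)) =
    - (one_hat \<bullet>
         (\<Sum>f\<in>{FaceL, FaceR}.
            (face_normal f * fstar t f) *\<^sub>R basis_row B (face_coord f)))"
proof
  fix t
  assume t: "t \<in> T"
  let ?K = "esfr_mass p B \<xi> w J c"
  let ?flux = "modal_flux B \<xi> w J (u t)"
  let ?adv = "transpose (basis_mat B \<xi>) ** sol_diag B \<xi> (u t) ** diag_mat w ** deriv_basis_mat B \<xi>"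
  let ?faces = "\<Sum>f\<in>{FaceL, FaceR}.
      (face_normal f * (fstar t f - \<alpha> * (basis_row B (face_coord f) \<bullet> ?flux)
        - (1 - \<alpha>) * face_flux B (u t) f)) *\<^sub>R basis_row B (face_coord f)"
  \<comment> \<open>one-sided derivatives at end points of \<open>T\<close> are unique because \<open>T\<close> is a nondegenerate interval\<close>
  have "at t within T \<noteq> bot"
  proof -
    have "\<not> T \<subseteq> {t}"
      using time(2) by (metis empty_interior_finite finite.emptyI finite_insert finite_subset)
    then have "t islimpt T"
      using time(1) t connected_imp_perfect[of T t] is_interval_connected[of T] by blast
    then show ?thesis
      by (simp add: trivial_limit_within)
  qed
  then have "vector_derivative u (at t within T) = esfr_split_rhs p B \<xi> w J c \<alpha> (fstar t) (u t)"
    using scheme[OF t] by (rule vector_derivative_within)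
  also have "\<dots> = matrix_inv ?K *v
      (- (\<alpha> *\<^sub>R (stiffness B \<xi> w *v ?flux)) - (1 - \<alpha>) *\<^sub>R (?adv *v u t) - ?faces)"
    by (simp add: esfr_split_rhs_def linear_diff[OF matrix_vector_mul_linear]
        linear_neg[OF matrix_vector_mul_linear] linear_cmul[OF matrix_vector_mul_linear]
        matrix_mul_assoc matrix_vector_mul_assoc del: sum.insert)
  finally have balance: "?K *v vector_derivative u (at t within T) =
      - (\<alpha> *\<^sub>R (stiffness B \<xi> w *v ?flux)) - (1 - \<alpha>) *\<^sub>R (?adv *v u t) - ?faces"
    using matrix_inv_right[OF inv_MK] by (simp add: matrix_vector_mul_assoc del: sum.insert)
  have conservative: "one_hat \<bullet> (stiffness B \<xi> w *v ?flux) =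
      basis_row B 1 \<bullet> ?flux - basis_row B (- 1) \<bullet> ?flux"
    using degree_of_exactness one_hat nodes
    by (intro test_one_conservative_volume[OF basis exact]) auto
  have advective: "one_hat \<bullet> (?adv *v u t) = face_flux B (u t) FaceR - face_flux B (u t) FaceL"
    using degree_of_exactness one_hat nodes
    by (intro test_one_advective_volume[OF basis exact]) auto
  have faces: "one_hat \<bullet> basis_row B (- 1) = 1" "one_hat \<bullet> basis_row B 1 = 1"
    using one_hat[of "- 1"] one_hat[of 1] by (simp_all add: inner_commute)
  show "one_hat \<bullet> (?K *v vector_derivative u (at t within T)) =
      - (one_hat \<bullet> (\<Sum>f\<in>{FaceL, FaceR}. (face_normal f * fstar t f) *\<^sub>R basis_row B (face_coord f)))"
    unfolding balance by (simp add: inner_simps conservative advective faces) (simp add: algebra_simps)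
qed

end
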